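(* Fix $m=(p,q)\in\mathcal M$ and $Z=(X,Y)\in\mathcal M$, and let $A=A_m(Z)=d_M(p,X)^2$ and $B=B_m(Z)=d_N(q,Y)^2$. If $A+B>0$, then for all $\alpha\in(0,2)$ $$\frac{\partial}{\partial\alpha}\,\frac{\alpha A-(2-\alpha)B}{\alpha A+(2-\alpha)B}=\frac{4AB}{\{\alpha A+(2-\alpha)B\}^2}\ge0.$$ Thus $\alpha\mapsto h_\alpha(Z;m)$ is nondecreasing on $(0,2)$, and it is strictly increasing whenever $A>0$ and $B>0$.
   Context: $(M,g_M)$ and $(N,g_N)$ are smooth, connected, complete Riemannian manifolds with geodesic distances $d_M,d_N$, and $\mathcal M=M\times N$. The balance function is $h_\alpha(Z;m)=\dfrac{\alpha A_m(Z)-(2-\alpha)B_m(Z)}{\alpha A_m(Z)+(2-\alpha)B_m(Z)}$ for $\alpha\in(0,2)$, whenever the denominator is nonzero. *)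

theory Defs
  imports "HOL-Analysis.Analysis"
begin

section \<open>Smooth functions\<close>

text \<open>
  Meant for open \<open>U\<close> and finite-dimensional \<open>'e\<close>, where continuity of all iterated
  directional derivatives is the usual \<open>C\<^sup>k\<close> property.
\<close>

primrec Ck_on :: "nat \<Rightarrow> 'e::real_normed_vector set \<Rightarrow> ('e \<Rightarrow> 'f::real_normed_vector) \<Rightarrow> bool" where
  "Ck_on 0 U f \<longleftrightarrow> continuous_on U f"
| "Ck_on (Suc k) U f \<longleftrightarrow>
     (\<forall>x\<in>U. f differentiable (at x)) \<and> (\<forall>v. Ck_on k U (\<lambda>x. frechet_derivative f (at x) v))"

definition smooth_on :: "'e::real_normed_vector set \<Rightarrow> ('e \<Rightarrow> 'f::real_normed_vector) \<Rightarrow> bool" where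
  "smooth_on U f \<longleftrightarrow> (\<forall>k. Ck_on k U f)"

section \<open>Riemannian manifolds\<close>

text \<open>
  The points are the elements of \<open>topspace (mtop M)\<close>. A chart is a domain together with a coordinate
  map, whose values outside the domain are irrelevant. The model space \<open>'e\<close> is only required to be a
  finite-dimensional normed space, rather than a \<open>euclidean_space\<close>, so that dimension \<open>0\<close> is not
  excluded. The Riemannian metric is given by its coordinate expressions: \<open>gform M c x u v\<close> is the
  inner product at the point \<open>x\<close> of the tangent vectors whose components in the chart \<open>c\<close> are
  \<open>u\<close> and \<open>v\<close>.
\<close>

type_synonym ('a, 'e) chart = "'a set \<times> ('a \<Rightarrow> 'e)"

record ('a, 'e) riem =
  mtop :: "'a topology"
  atlas :: "('a, 'e) chart set"
  gform :: "('a, 'e) chart \<Rightarrow> 'a \<Rightarrow> 'e \<Rightarrow> 'e \<Rightarrow> real"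

abbreviation points :: "('a, 'e, 'z) riem_scheme \<Rightarrow> 'a set" where
  "points M \<equiv> topspace (mtop M)"

definition transition :: "('a, 'e) chart \<Rightarrow> ('a, 'e) chart \<Rightarrow> 'e \<Rightarrow> 'e" where
  "transition c c' = snd c' \<circ> inv_into (fst c) (snd c)"

definition smooth_manifold :: "('a, 'e::real_normed_vector) riem \<Rightarrow> bool" where
  "smooth_manifold M \<longleftrightarrow>
     (\<exists>B::'e set. finite B \<and> span B = UNIV) \<and>
     Hausdorff_space (mtop M) \<and> second_countable (mtop M) \<and>
     (\<forall>(U, \<phi>)\<in>atlas M. openin (mtop M) U \<and> open (\<phi> ` U) \<and>
        homeomorphic_map (subtopology (mtop M) U) (top_of_set (\<phi> ` U)) \<phi>) \<and>
     \<Union> (fst ` atlas M) = points M \<and>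
     (\<forall>c\<in>atlas M. \<forall>c'\<in>atlas M. smooth_on (snd c ` (fst c \<inter> fst c')) (transition c c'))"

definition riemannian_metric :: "('a, 'e::real_normed_vector) riem \<Rightarrow> bool" where
  "riemannian_metric M \<longleftrightarrow>
     (\<forall>c\<in>atlas M. \<forall>x\<in>fst c.
        bilinear (gform M c x) \<and>
        (\<forall>u v. gform M c x u v = gform M c x v u) \<and>
        (\<forall>u. u \<noteq> 0 \<longrightarrow> 0 < gform M c x u u)) \<and>
     (\<forall>c\<in>atlas M. \<forall>u v.
        smooth_on (snd c ` fst c) (\<lambda>y. gform M c (inv_into (fst c) (snd c) y) u v)) \<and>
     (\<forall>c\<in>atlas M. \<forall>c'\<in>atlas M. \<forall>x\<in>fst c \<inter> fst c'. \<forall>u v.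
        let D = frechet_derivative (transition c c') (at (snd c x))
        in gform M c x u v = gform M c' x (D u) (D v))"

section \<open>Geodesic distance\<close>

definition C1_curve_on :: "('a, 'e::real_normed_vector) riem \<Rightarrow> real set \<Rightarrow> (real \<Rightarrow> 'a) \<Rightarrow> bool" where
  "C1_curve_on M I \<gamma> \<longleftrightarrow>
     continuous_map (top_of_set I) (mtop M) \<gamma> \<and>
     (\<forall>(U, \<phi>)\<in>atlas M.
        (\<forall>t\<in>{t\<in>I. \<gamma> t \<in> U}. (\<phi> \<circ> \<gamma>) differentiable (at t within I)) \<and>
        continuous_on {t\<in>I. \<gamma> t \<in> U} (\<lambda>t. vector_derivative (\<phi> \<circ> \<gamma>) (at t within I)))"

text \<open>Here \<open>S\<close> is the set of break points.\<close>

definition piecewise_C1_curve :: "('a, 'e::real_normed_vector) riem \<Rightarrow> (real \<Rightarrow> 'a) \<Rightarrow> bool" where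
  "piecewise_C1_curve M \<gamma> \<longleftrightarrow>
     (\<exists>S. finite S \<and> {0, 1} \<subseteq> S \<and> S \<subseteq> {0..1} \<and>
       (\<forall>a\<in>S. \<forall>b\<in>S. a < b \<and> {a<..<b} \<inter> S = {} \<longrightarrow> C1_curve_on M {a..b} \<gamma>))"

text \<open>
  The value does not depend on the chosen chart, by the transformation law of the metric. The speed is
  only meaningful off the (finitely many) break points, which do not affect the length.
\<close>

definition speed :: "('a, 'e::real_normed_vector) riem \<Rightarrow> (real \<Rightarrow> 'a) \<Rightarrow> real \<Rightarrow> real" where
  "speed M \<gamma> t =
     (let c = (SOME c. c \<in> atlas M \<and> \<gamma> t \<in> fst c);
          v = vector_derivative (snd c \<circ> \<gamma>) (at t)
      in sqrt (gform M c (\<gamma> t) v v))"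

definition curve_length :: "('a, 'e::real_normed_vector) riem \<Rightarrow> (real \<Rightarrow> 'a) \<Rightarrow> real" where
  "curve_length M \<gamma> = integral {0..1} (speed M \<gamma>)"

text \<open>
  The value \<open>0\<close> off the manifold is a dummy; \<open>Metric_space\<close> wants a distance that is nonnegative
  and symmetric on the whole type.
\<close>

definition geodesic_dist :: "('a, 'e::real_normed_vector) riem \<Rightarrow> 'a \<Rightarrow> 'a \<Rightarrow> real" where
  "geodesic_dist M x y =
     (if x \<in> points M \<and> y \<in> points M
      then Inf {curve_length M \<gamma> | \<gamma>. piecewise_C1_curve M \<gamma> \<and> \<gamma> 0 = x \<and> \<gamma> 1 = y}
      else 0)"

definition complete_riemannian_manifold :: "('a, 'e::real_normed_vector) riem \<Rightarrow> bool" where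
  "complete_riemannian_manifold M \<longleftrightarrow>
     smooth_manifold M \<and> riemannian_metric M \<and> connected_space (mtop M) \<and>
     Metric_space.mcomplete (points M) (geodesic_dist M)"

section \<open>The balance function\<close>

definition A_sq :: "('a, 'e::real_normed_vector) riem \<Rightarrow> 'a \<times> 'b \<Rightarrow> 'a \<times> 'b \<Rightarrow> real" where
  "A_sq M m Z = (geodesic_dist M (fst m) (fst Z))\<^sup>2"

definition B_sq :: "('b, 'f::real_normed_vector) riem \<Rightarrow> 'a \<times> 'b \<Rightarrow> 'a \<times> 'b \<Rightarrow> real" where
  "B_sq N m Z = (geodesic_dist N (snd m) (snd Z))\<^sup>2"

text \<open>Meaningful only for a nonzero denominator; division by zero yields \<open>0\<close>.\<close>

definition balance :: "('a, 'e::real_normed_vector) riem \<Rightarrow> ('b, 'f::real_normed_vector) riem \<Rightarrow>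
    real \<Rightarrow> 'a \<times> 'b \<Rightarrow> 'a \<times> 'b \<Rightarrow> real" where
  "balance M N \<alpha> Z m =
     (\<alpha> * A_sq M m Z - (2 - \<alpha>) * B_sq N m Z) / (\<alpha> * A_sq M m Z + (2 - \<alpha>) * B_sq N m Z)"

end

theory Submission
  imports Defs
begin

text \<open>Being squares of distances, \<open>A\<close> and \<open>B\<close> are nonnegative, and
  they do not both vanish; the weights \<alpha> and 2 - \<alpha> are positive on (0,2), so the
  denominator \<open>D\<close> is positive there. What remains is algebra of a quotient of two
  affine functions of \<alpha>. Monotonicity is read off an exact formula for the difference of two
  values, \<open>balance_quotient_diff\<close>, whose sign is that of A B (y - x); this gives the
  weak and the strict case alike, with no appeal to the mean value theorem. The derivative formula
  is a separate application of the quotient rule.\<close>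

lemma balance_denominator_pos:
  fixes A B \<alpha> :: real
  assumes "A \<ge> 0" "B \<ge> 0" "A + B > 0" "\<alpha> \<in> {0<..<2}"
  shows "\<alpha> * A + (2 - \<alpha>) * B > 0"
proof (cases "A > 0")
  case True
  then show ?thesis using assms by (intro add_pos_nonneg) auto
next
  \<comment> \<open>Here A = 0, so A + B > 0 forces B > 0, and the second summand is the positive
    one.\<close>
  case False
  then show ?thesis using assms by (intro add_nonneg_pos) auto
qed

text \<open>After cross-multiplication the terms in A^2 and B^2 cancel; the mixed terms leave 2 A B
  (y (2 - x) - x (2 - y)) = 4 A B (y - x).\<close>

lemma balance_quotient_diff:
  fixes A B x y :: real
  assumes "x * A + (2 - x) * B \<noteq> 0" "y * A + (2 - y) * B \<noteq> 0"
  shows "(y * A - (2 - y) * B) / (y * A + (2 - y) * B) - (x * A - (2 - x) * B) / (x * A + (2 - x) * B)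
    = 4 * A * B * (y - x) / ((y * A + (2 - y) * B) * (x * A + (2 - x) * B))"
  unfolding diff_frac_eq[OF assms(2,1)] by (rule arg_cong2[where f = "(/)"]) (auto simp: algebra_simps)

text \<open>Numerator and denominator have slopes A + B and A - B, and the quotient rule's numerator
  collapses to 2 A B ((2 - \<alpha>) + \<alpha>) = 4 A B.\<close>

lemma balance_quotient_has_derivative:
  fixes A B \<alpha> :: real
  assumes "\<alpha> * A + (2 - \<alpha>) * B \<noteq> 0"
  shows "((\<lambda>\<alpha>. (\<alpha> * A - (2 - \<alpha>) * B) / (\<alpha> * A + (2 - \<alpha>) * B))
    has_real_derivative 4 * A * B / (\<alpha> * A + (2 - \<alpha>) * B)\<^sup>2) (at \<alpha>)"
  using assms
  by (auto intro!: derivative_eq_intros arg_cong2[where f = "(/)"] simp: power2_eq_square algebra_simps)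

theorem lemma20:
  fixes M :: "('a, 'e::real_normed_vector) riem"
    and N :: "('b, 'f::real_normed_vector) riem"
    and m Z :: "'a \<times> 'b" and p X :: 'a and q Y :: 'b and A B :: real
  assumes "complete_riemannian_manifold M" and "complete_riemannian_manifold N"
    and "m = (p, q)" and "m \<in> points M \<times> points N"
    and "Z = (X, Y)" and "Z \<in> points M \<times> points N"
    and "A = A_sq M m Z" and "B = B_sq N m Z"
    and "A + B > 0"
  shows "(\<forall>\<alpha>\<in>{0<..<2}.
            \<alpha> * A + (2 - \<alpha>) * B \<noteq> 0 \<and>
            ((\<lambda>\<alpha>. (\<alpha> * A - (2 - \<alpha>) * B) / (\<alpha> * A + (2 - \<alpha>) * B))
               has_real_derivative 4 * A * B / (\<alpha> * A + (2 - \<alpha>) * B)\<^sup>2) (at \<alpha>) \<and>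
            4 * A * B / (\<alpha> * A + (2 - \<alpha>) * B)\<^sup>2 \<ge> 0) \<and>
         mono_on {0<..<2} (\<lambda>\<alpha>. balance M N \<alpha> Z m) \<and>
         (A > 0 \<and> B > 0 \<longrightarrow> strict_mono_on {0<..<2} (\<lambda>\<alpha>. balance M N \<alpha> Z m))"
proof -
  let ?D = "\<lambda>\<alpha>. \<alpha> * A + (2 - \<alpha>) * B"
  have AB: "A \<ge> 0" "B \<ge> 0"
    using assms by (auto simp: A_sq_def B_sq_def)
  have D: "?D \<alpha> > 0" if "\<alpha> \<in> {0<..<2}" for \<alpha>
    using balance_denominator_pos[OF AB \<open>A + B > 0\<close> that] .
  have diff: "balance M N y Z m - balance M N x Z m = 4 * A * B * (y - x) / (?D y * ?D x)"
    if "x \<in> {0<..<2}" "y \<in> {0<..<2}" for x y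
    unfolding balance_def \<open>A = A_sq M m Z\<close>[symmetric] \<open>B = B_sq N m Z\<close>[symmetric]
    using D[OF that(1)] D[OF that(2)] by (intro balance_quotient_diff) auto
  have "mono_on {0<..<2} (\<lambda>\<alpha>. balance M N \<alpha> Z m)"
  proof (rule mono_onI)
    fix x y :: real
    assume xy: "x \<in> {0<..<2}" "y \<in> {0<..<2}" "x \<le> y"
    \<comment> \<open>If \<open>A\<close> or \<open>B\<close> is zero this is an equality: the
      balance is then constant on the interval.\<close>
    have "0 \<le> 4 * A * B * (y - x) / (?D y * ?D x)"
      using AB D[OF xy(1)] D[OF xy(2)] xy(3)
      by (intro divide_nonneg_pos mult_nonneg_nonneg mult_pos_pos) auto
    then show "balance M N x Z m \<le> balance M N y Z m"
      using diff[OF xy(1,2)] by linarith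
  qed
  moreover have "strict_mono_on {0<..<2} (\<lambda>\<alpha>. balance M N \<alpha> Z m)" if "A > 0" "B > 0"
  proof (rule strict_mono_onI)
    fix x y :: real
    assume xy: "x \<in> {0<..<2}" "y \<in> {0<..<2}" "x < y"
    have "0 < 4 * A * B * (y - x) / (?D y * ?D x)"
      using that D[OF xy(1)] D[OF xy(2)] xy(3)
      by (intro divide_pos_pos mult_pos_pos) auto
    then show "balance M N x Z m < balance M N y Z m"
      using diff[OF xy(1,2)] by linarith
  qed
  moreover have "?D \<alpha> \<noteq> 0" if "\<alpha> \<in> {0<..<2}" for \<alpha>
    using D[OF that] by simp
  \<comment> \<open>True for every real \<alpha>: where the denominator vanishes, the quotient is 0
    by convention.\<close>
  moreover have "4 * A * B / (?D \<alpha>)\<^sup>2 \<ge> 0" for \<alpha>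
    using AB by simp
  ultimately show ?thesis
    using balance_quotient_has_derivative by blast
qed

end
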